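(* Let $S$ be a (finite) $\mathscr R$-trivial semigroup. Then the following are equivalent. (1) $S$ is connected. (2) The semigroup ring $\mathbb ZS$ has a (two-sided) identity. (3) The semigroup algebra $kS$ is unital for all commutative rings $k$.
   Context: All semigroups are finite. Commutative rings have a unit. $S^1$ denotes $S$ with an adjoined identity. Write $s\leq_{\mathscr R}t$ iff $sS^1\subseteq tS^1$; $S$ is $\mathscr R$-trivial if $\leq_{\mathscr R}$ is a partial order. For $s\in S$, $s^\omega$ denotes the unique idempotent power of $s$. For $S$ $\mathscr R$-trivial, $\Lambda(S)$ is the set of left ideals of the form $Se$ with $e\in S$ idempotent; it is closed under intersection, hence is a meet semilattice, and $c\colon S\to\Lambda(S)$, $c(s)=Ss^\omega$, is a surjective homomorphism. An $\mathscr R$-trivial semigroup $S$ is connected if $s\in sS$ for all $s\in S$ and the equivalence relation $\{(s,t): c(s)=c(t)\}$ is the equivalence relation generated by all pairs $(s,t)$ such that $c(s)=c(t)$ and there is $x\in S$ with $xs=s$ and $xt=t$. *)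

theory Defs
  imports "HOL-Algebra.Module" "HOL-Algebra.IntRing"
begin

text \<open>
  A finite semigroup is a type of sort \<open>{finite, semigroup_mult}\<close>; properties of the semigroup
  as a whole take the argument \<open>TYPE('a)\<close>.  Rings of coefficients are records of HOL-Algebra,
  so that one can quantify over them inside a formula.
\<close>

section \<open>Finite semigroups\<close>

text \<open>\<open>right_ideal1 s\<close> is $sS^1$ and \<open>left_ideal s\<close> is $Ss$ (no identity adjoined).\<close>

definition right_ideal1 :: "'a::semigroup_mult \<Rightarrow> 'a set" where
  "right_ideal1 s = insert s (range (\<lambda>x. s * x))"

definition left_ideal :: "'a::semigroup_mult \<Rightarrow> 'a set" where
  "left_ideal s = range (\<lambda>x. x * s)"

definition le_R :: "'a::semigroup_mult \<Rightarrow> 'a \<Rightarrow> bool" where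
  "le_R s t \<longleftrightarrow> right_ideal1 s \<subseteq> right_ideal1 t"

definition R_trivial :: "'a::semigroup_mult itself \<Rightarrow> bool" where
  "R_trivial (_ :: 'a itself) \<longleftrightarrow> partial_order_on UNIV {(s :: 'a, t). le_R s t}"

text \<open>There is no zeroth power in a semigroup: \<open>spow s n\<close> is $s^{n+1}$.\<close>

primrec spow :: "'a::semigroup_mult \<Rightarrow> nat \<Rightarrow> 'a" where
  "spow s 0 = s"
| "spow s (Suc n) = spow s n * s"

lemma spow_mult: "spow s m * spow s n = spow s (Suc (m + n))"
  by (induction n) (simp_all flip: mult.assoc)

lemma spow_spow: "spow (spow s m) n = spow s (m + n * Suc m)"
proof (induction n)
  case (Suc n)
  have "spow (spow s m) (Suc n) = spow s (Suc (m + n * Suc m + m))"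
    using Suc by (simp only: spow.simps spow_mult)
  also have "Suc (m + n * Suc m + m) = m + Suc n * Suc m" by simp
  finally show ?case .
qed simp

lemma spow_idem: "e * e = e \<Longrightarrow> spow e n = e"
  by (induction n) simp_all

lemma ex1_idempotent_power:
  fixes s :: "'a::{finite, semigroup_mult}"
  shows "\<exists>!e. e * e = e \<and> (\<exists>n. e = spow s n)"
proof (rule ex_ex1I)
  have "\<not> inj (spow s)"
    using finite_imageD[of "spow s" UNIV] by auto
  then obtain i j where ij: "spow s i = spow s j" "i < j"
    by (metis linorder_inj_onI' UNIV_I)
  define p where "p = j - i"
  have p: "p > 0" and per: "spow s i = spow s (i + p)"
    using ij by (simp_all add: p_def)
  have per1: "spow s n = spow s (n + p)" if "i \<le> n" for n
    using that
  proof (induction n rule: dec_induct)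
    case base show ?case by (rule per)
  qed simp
  have perk: "spow s n = spow s (n + k * p)" if "i \<le> n" for n k
  proof (induction k)
    case (Suc k)
    have "spow s (n + k * p) = spow s (n + k * p + p)"
      using that by (intro per1) simp
    then show ?case using Suc by (simp add: algebra_simps)
  qed simp
  define n where "n = Suc i * p - 1"
  have "Suc i * 1 \<le> Suc i * p" using p by (intro mult_le_mono2) simp
  then have n: "i \<le> n" "Suc n = Suc i * p" by (simp_all add: n_def)
  have "spow s n * spow s n = spow s (n + Suc i * p)"
    by (simp only: spow_mult flip: n(2)) simp
  also have "\<dots> = spow s n" using perk[OF n(1), of "Suc i"] by (simp only:)
  finally show "\<exists>e. e * e = e \<and> (\<exists>n. e = spow s n)" by blast
next
  fix e f
  assume e: "e * e = e \<and> (\<exists>n. e = spow s n)" and f: "f * f = f \<and> (\<exists>n. f = spow s n)"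
  then obtain m n where m: "e = spow s m" and n: "f = spow s n" by blast
  have "e = spow s (m + n * Suc m)" using e m spow_spow[of s m n] spow_idem[of e n] by simp
  also have "m + n * Suc m = n + m * Suc n" by simp
  also have "spow s (n + m * Suc n) = f" using f n spow_spow[of s n m] spow_idem[of f m] by simp
  finally show "e = f" .
qed

definition omega :: "'a::{finite, semigroup_mult} \<Rightarrow> 'a" where
  "omega s = (THE e. e * e = e \<and> (\<exists>n. e = spow s n))"

text \<open>The homomorphism $c \colon S \to \Lambda(S)$, $c(s) = S s^\omega$.\<close>

definition c_hom :: "'a::{finite, semigroup_mult} \<Rightarrow> 'a set" where
  "c_hom s = left_ideal (omega s)"

definition connected_semigroup :: "'a::{finite, semigroup_mult} itself \<Rightarrow> bool" where
  "connected_semigroup (_ :: 'a itself) \<longleftrightarrow>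
     (\<forall>s :: 'a. s \<in> range (\<lambda>x. s * x)) \<and>
     (\<lambda>s t :: 'a. c_hom s = c_hom t) =
       equivclp (\<lambda>s t. c_hom s = c_hom t \<and> (\<exists>x. x * s = s \<and> x * t = t))"


section \<open>Semigroup algebras\<close>

text \<open>
  Since the semigroup is finite, its semigroup algebra over \<open>k\<close> consists of all functions from it
  to \<open>k\<close>, with convolution as multiplication.  The record type forces a value for the field
  \<open>one\<close>; it is left unspecified because the algebra need not have an identity, and \<open>unital\<close>
  does not refer to it.
\<close>

definition semigroup_algebra ::
    "('r, 'm) ring_scheme \<Rightarrow> 'a::{finite, semigroup_mult} itself \<Rightarrow> ('r, 'a \<Rightarrow> 'r) module" where
  "semigroup_algebra k (_ :: 'a itself) =
     \<lparr>carrier = UNIV \<rightarrow> carrier k,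
      monoid.mult = (\<lambda>f g u. \<Oplus>\<^bsub>k\<^esub>p \<in> {p. fst p * snd p = u}. f (fst p) \<otimes>\<^bsub>k\<^esub> g (snd p)),
      one = undefined,
      zero = (\<lambda>s. \<zero>\<^bsub>k\<^esub>),
      add = (\<lambda>f g s. f s \<oplus>\<^bsub>k\<^esub> g s),
      smult = (\<lambda>a f s. a \<otimes>\<^bsub>k\<^esub> f s)\<rparr>"

definition unital :: "('b, 'm) monoid_scheme \<Rightarrow> bool" where
  "unital A \<longleftrightarrow>
     (\<exists>e \<in> carrier A. \<forall>a \<in> carrier A. e \<otimes>\<^bsub>A\<^esub> a = a \<and> a \<otimes>\<^bsub>A\<^esub> e = a)"

text \<open>
  In the theorem, the quantifier over all commutative rings ranges over the HOL-Algebra rings, with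
  arbitrary carrier set, on a type \<open>'r\<close>, because HOL has no quantification over types
  inside a formula.  The premise that \<open>'r\<close> is infinite is a condition on this universe, not
  on the rings: over a small type the quantifier would be too weak (over \<open>unit\<close> it would only
  reach the zero ring).  No ring is lost up to isomorphism, as a ring on a finite type can be copied
  onto a subset of an infinite one.
\<close>

end

theory Submission
  imports Defs
begin

text \<open>
  Suppose a coefficient ring with \<open>1 \<noteq> 0\<close> gives an identity \<open>e = \<Sum>\<^sub>x a\<^sub>x x\<close>.  Every \<open>x\<close> then has a
  left-fixing \<open>y\<close>, so \<open>c(s) = c(t)\<close> puts \<open>xs\<close> and \<open>xt\<close> in the same class \<open>C\<close> of the generated
  equivalence.  Hence the sum of \<open>a\<^sub>x\<close> over \<open>xs \<in> C\<close> equals that over \<open>xt \<in> C\<close>; these sums are 1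
  or 0 according to whether \<open>s\<close>, respectively \<open>t\<close>, lies in \<open>C\<close>.

  Conversely, \<open>s \<in> sS\<close> for all \<open>s\<close> gives an integral right identity \<open>\<eta>\<close>, by multiplying factors
  \<open>1 - x\<close> along a filtration by right ideals.  Then \<open>1 - \<eta>\<close> is idempotent and \<open>S(1 - \<eta>) = 0\<close>.
  Filter the ring by the ideals spanned by \<open>c\<close>-classes and descend: connectedness makes
  \<open>(1 - \<eta>)s\<close> constant on each class modulo the smaller ones, and its value at an idempotent \<open>e\<close>
  vanishes since \<open>e(1 - \<eta>) = 0\<close>.  So \<open>(1 - \<eta>)S = 0\<close>, and \<open>\<eta>\<close> is two-sided.
\<close>

section \<open>The homomorphism to the semilattice of left ideals\<close>

lemma R_trivialD:
  fixes s :: "'a::semigroup_mult"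
  assumes "R_trivial TYPE('a)" and "s * x * y = s"
  shows "s * x = s"
proof -
  have "le_R (s * x) s"
    by (auto simp: le_R_def right_ideal1_def mult.assoc)
  moreover have "le_R s (s * x)"
    unfolding le_R_def right_ideal1_def
    using assms(2) by (auto simp: image_iff) (metis mult.assoc)+
  ultimately show ?thesis
    using assms(1) by (auto simp: R_trivial_def partial_order_on_def antisym_def)
qed

lemma omega_props:
  fixes s :: "'a::{finite, semigroup_mult}"
  shows omega_idem: "omega s * omega s = omega s"
    and omega_power: "\<exists>n. omega s = spow s n"
  unfolding omega_def using theI'[OF ex1_idempotent_power[of s]] by blast+

lemma omega_of_idem:
  fixes e :: "'a::{finite, semigroup_mult}"
  assumes "e * e = e"
  shows "omega e = e"
  using omega_power[of e] spow_idem[OF assms] by auto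

lemma mult_spow_fixed:
  assumes "e * u = e"
  shows "e * spow u n = e"
  by (induction n) (simp_all add: assms mult.assoc[symmetric])

lemma spow_mult_fixed:
  assumes "p * w = w"
  shows "spow p n * w = w"
  by (induction n) (simp_all add: assms mult.assoc)

lemma spow_left_factor: "spow u n = u \<or> (\<exists>y. spow u n = u * y)"
  by (induction n) (auto simp: mult.assoc)

text \<open>Turns inclusion of left ideals into an equation. If \<open>e\<close> lies in
  \<open>c_hom u\<close>, then \<open>e * omega u = e\<close>, so \<open>e * u\<close> generates the
  same right ideal as \<open>e\<close> and equals it by R-triviality.\<close>

lemma idem_fixed_iff:
  fixes e u :: "'a::{finite, semigroup_mult}"
  assumes R: "R_trivial TYPE('a)" and e: "e * e = e"
  shows "e * u = e \<longleftrightarrow> c_hom e \<subseteq> c_hom u"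
proof
  assume "e * u = e"
  then have "e * omega u = e"
    using mult_spow_fixed omega_power[of u] by metis
  then show "c_hom e \<subseteq> c_hom u"
    by (auto simp: c_hom_def left_ideal_def omega_of_idem[OF e] image_iff) (metis mult.assoc)
next
  assume "c_hom e \<subseteq> c_hom u"
  moreover have "e \<in> c_hom e"
    by (metis c_hom_def e left_ideal_def omega_of_idem rangeI)
  ultimately obtain x where "e = x * omega u"
    by (auto simp: c_hom_def left_ideal_def)
  then have "e * omega u = e"
    by (simp add: mult.assoc omega_idem)
  then obtain n where n: "e * spow u n = e"
    using omega_power[of u] by metis
  show "e * u = e"
    using spow_left_factor[of u n] n R_trivialD[OF R, of e u] by (metis mult.assoc)
qed

lemma c_hom_omega: "c_hom (omega s) = c_hom s"
  by (simp add: c_hom_def omega_of_idem[OF omega_idem])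

lemma c_hom_subset_iff:
  fixes s t :: "'a::{finite, semigroup_mult}"
  assumes R: "R_trivial TYPE('a)"
  shows "c_hom s \<subseteq> c_hom t \<longleftrightarrow> (\<forall>e. e * e = e \<longrightarrow> e * s = e \<longrightarrow> e * t = e)"
  using idem_fixed_iff[OF R] by (metis c_hom_omega omega_idem order.refl order.trans)

text \<open>Together with \<open>c_hom_subset_iff\<close> this serves as the homomorphism property
  of \<open>c_hom\<close>. R-triviality gives \<open>e * x = e\<close>, and the other factor
  follows.\<close>

lemma idem_fixed_mult_iff:
  fixes e :: "'a::{finite, semigroup_mult}"
  assumes R: "R_trivial TYPE('a)"
  shows "e * (x * y) = e \<longleftrightarrow> e * x = e \<and> e * y = e"
  using R_trivialD[OF R, of e x y] by (metis mult.assoc)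

lemma c_hom_mult_subset:
  fixes x y :: "'a::{finite, semigroup_mult}"
  assumes R: "R_trivial TYPE('a)"
  shows "c_hom (x * y) \<subseteq> c_hom x" and "c_hom (x * y) \<subseteq> c_hom y"
  by (auto simp: c_hom_subset_iff[OF R] idem_fixed_mult_iff[OF R])

lemma c_hom_mult_cong:
  fixes x :: "'a::{finite, semigroup_mult}"
  assumes R: "R_trivial TYPE('a)" and "c_hom s = c_hom t"
  shows "c_hom (x * s) = c_hom (x * t)"
  using assms(2)
  by (auto simp: c_hom_subset_iff[OF R] idem_fixed_mult_iff[OF R] set_eq_subset)

lemma c_hom_mult_same:
  fixes u :: "'a::{finite, semigroup_mult}"
  assumes R: "R_trivial TYPE('a)" and "c_hom u = c_hom t"
  shows "c_hom (u * t) = c_hom t"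
proof
  have "e * u = e \<longleftrightarrow> e * t = e" if "e * e = e" for e
    using that by (simp add: idem_fixed_iff[OF R] assms(2))
  then show "c_hom t \<subseteq> c_hom (u * t)"
    by (simp add: c_hom_subset_iff[OF R] idem_fixed_mult_iff[OF R])
qed (rule c_hom_mult_subset(2)[OF R])

text \<open>Two values of \<open>omega p * w\<close> are compared: it is \<open>w\<close> because
  \<open>p\<close> fixes \<open>w\<close>, and \<open>omega p\<close> because of the inclusion. So
  \<open>w\<close> is the idempotent \<open>omega p\<close>.\<close>

lemma idem_if_left_fixed:
  fixes p w :: "'a::{finite, semigroup_mult}"
  assumes R: "R_trivial TYPE('a)" and "p * w = w" and "c_hom p \<subseteq> c_hom w"
  shows "w * w = w"
proof -
  have "omega p * w = w"
    using spow_mult_fixed[OF assms(2)] omega_power[of p] by metis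
  moreover have "omega p * w = omega p"
    using idem_fixed_iff[OF R omega_idem] assms(3) by (simp add: c_hom_omega)
  ultimately show ?thesis
    using omega_idem by metis
qed


section \<open>Identities of the integral semigroup ring\<close>

definition edge :: "'a::{finite, semigroup_mult} \<Rightarrow> 'a \<Rightarrow> bool" where
  "edge s t \<longleftrightarrow> c_hom s = c_hom t \<and> (\<exists>x. x * s = s \<and> x * t = t)"

lemma edge_c_hom: "equivclp edge s t \<Longrightarrow> c_hom s = c_hom t"
  by (induction rule: equivclp_induct) (auto simp: edge_def)

lemma connected_semigroup_iff:
  "connected_semigroup TYPE('a::{finite, semigroup_mult}) \<longleftrightarrow>
    (\<forall>s :: 'a. \<exists>x. s * x = s) \<and> (\<forall>s t :: 'a. c_hom s = c_hom t \<longrightarrow> equivclp edge s t)"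
proof -
  have edge: "(\<lambda>s t :: 'a. c_hom s = c_hom t \<and> (\<exists>x. x * s = s \<and> x * t = t)) = edge"
    by (simp add: edge_def fun_eq_iff)
  have "(\<lambda>s t :: 'a. c_hom s = c_hom t) = equivclp edge \<longleftrightarrow>
      (\<forall>s t :: 'a. c_hom s = c_hom t \<longrightarrow> equivclp edge s t)"
    using edge_c_hom unfolding fun_eq_iff by blast
  moreover have "(\<forall>s :: 'a. s \<in> range (\<lambda>x. s * x)) \<longleftrightarrow> (\<forall>s :: 'a. \<exists>x. s * x = s)"
    unfolding image_iff by (simp add: eq_commute[where b = "_ * _"])
  ultimately show ?thesis
    unfolding connected_semigroup_def edge by (simp only:)
qed

text \<open>A chain of edges joins \<open>w\<close> to the idempotent \<open>omega w\<close>, which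
  fixes itself; the witness of the last edge fixes both its ends.\<close>

lemma connected_left_fixed:
  fixes w :: "'a::{finite, semigroup_mult}"
  assumes "connected_semigroup TYPE('a)"
  shows "\<exists>y. y * w = w"
proof -
  have "equivclp edge (omega w) w"
    using assms by (simp add: connected_semigroup_iff c_hom_omega)
  then show ?thesis
    by (induction rule: equivclp_induct) (use omega_idem edge_def in blast)+
qed

section \<open>Right identity from a filtration by right ideals\<close>

text \<open>A function \<open>\<eta>\<close> stands for the element \<open>\<Sum>\<^sub>v \<eta> v \<cdot> v\<close> of the
  integral semigroup ring; one-sided identities are tested against arbitrary functions.\<close>

lemma right_identity_exists:
  assumes R: "R_trivial TYPE('a::{finite, semigroup_mult})"
    and stab: "\<And>s :: 'a. \<exists>x. s * x = s"
  shows "\<exists>\<eta> :: 'a \<Rightarrow> int. \<forall>g s. (\<Sum>v\<in>UNIV. \<eta> v * g (s * v)) = g s"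
proof -
  \<comment> \<open>The filtration is climbed by maximality: a maximal \<open>good\<close> set other
    than \<open>UNIV\<close> could be enlarged by one element.\<close>
  define good where "good A \<longleftrightarrow> (\<forall>s\<in>A. \<forall>x. s * x \<in> A) \<and>
    (\<exists>\<eta> :: 'a \<Rightarrow> int. \<forall>s\<in>A. \<forall>g. (\<Sum>v\<in>UNIV. \<eta> v * g (s * v)) = g s)" for A :: "'a set"
  have "good {}"
    by (simp add: good_def)
  then obtain A where A: "good A" and max: "\<And>B. good B \<Longrightarrow> \<not> A \<subset> B"
    by (metis finite_has_maximal[of "Collect good"] mem_Collect_eq psubset_eq finite_code empty_iff)
  have "A = UNIV"
  proof (rule ccontr)
    assume "A \<noteq> UNIV"
    then have "\<exists>s. s \<notin> A" by auto
    \<comment> \<open>Minimality makes \<open>insert s A\<close> a right ideal: if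
      \<open>s * x\<close> is outside \<open>A\<close>, it generates the same right ideal as
      \<open>s\<close>, hence equals \<open>s\<close>.\<close>
    then obtain s where s: "s \<notin> A"
      and min: "\<And>t. t \<notin> A \<Longrightarrow> card (right_ideal1 s) \<le> card (right_ideal1 t)"
      using ex_has_least_nat[of "\<lambda>s. s \<notin> A" _ "\<lambda>s. card (right_ideal1 s)"] by metis
    have step: "s * x = s \<or> s * x \<in> A" for x
    proof (rule ccontr)
      assume *: "\<not> ?thesis"
      have "right_ideal1 (s * x) \<subseteq> right_ideal1 s"
        by (auto simp: right_ideal1_def mult.assoc)
      moreover have "card (right_ideal1 s) \<le> card (right_ideal1 (s * x))"
        using * by (intro min) auto
      ultimately have "right_ideal1 (s * x) = right_ideal1 s"
        by (meson card_seteq finite_code)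
      then have "s \<in> right_ideal1 (s * x)"
        by (auto simp: right_ideal1_def)
      then show False
        using * R_trivialD[OF R, of s x] by (auto simp: right_ideal1_def) metis
    qed
    from A obtain \<eta> :: "'a \<Rightarrow> int" where
      \<eta>: "\<And>t g. t \<in> A \<Longrightarrow> (\<Sum>v\<in>UNIV. \<eta> v * g (t * v)) = g t"
      and closed: "\<And>t x. t \<in> A \<Longrightarrow> t * x \<in> A"
      unfolding good_def by metis
    obtain e where e: "s * e = s" using stab by blast
    \<comment> \<open>\<open>1 - \<theta> = (1 - e)(1 - \<eta>)\<close>\<close>
    define \<theta> where "\<theta> v = (if v = e then 1 else 0) + \<eta> v - (\<Sum>w | e * w = v. \<eta> w)" for v
    have \<theta>: "(\<Sum>v\<in>UNIV. \<theta> v * G v) =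
        G e + (\<Sum>v\<in>UNIV. \<eta> v * G v) - (\<Sum>v\<in>UNIV. \<eta> v * G (e * v))" for G
    proof -
      have "(\<Sum>v\<in>UNIV. (\<Sum>w | e * w = v. \<eta> w) * G v) =
          (\<Sum>v\<in>UNIV. \<Sum>w | w \<in> UNIV \<and> e * w = v. \<eta> w * G (e * w))"
        by (simp add: sum_distrib_right)
      also have "\<dots> = (\<Sum>v\<in>UNIV. \<eta> v * G (e * v))"
        by (rule sum.group) auto
      moreover have "(\<Sum>v\<in>UNIV. (if v = e then 1 else 0) * G v) = G e"
        by (simp add: if_distrib[of "\<lambda>c. c * _"] cong: if_cong)
      ultimately show ?thesis
        by (simp add: \<theta>_def algebra_simps sum.distrib sum_subtractf)
    qed
    \<comment> \<open>On \<open>A\<close>, \<eta> fixes both \<open>t\<close> and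
      \<open>t * e\<close>, so the \<open>e\<close> terms cancel; at \<open>s\<close>, the equation
      \<open>s * e = s\<close> cancels the two sums over \<eta>.\<close>
    have "(\<Sum>v\<in>UNIV. \<theta> v * g (t * v)) = g t" if "t \<in> insert s A" for t g
    proof (cases "t \<in> A")
      case True
      then show ?thesis
        using \<eta>[OF True, of g] \<eta>[OF closed[OF True, of e], of g] by (simp add: \<theta> mult.assoc)
    next
      case False
      then have "t = s" using that by simp
      then show ?thesis
        using e by (simp add: \<theta> flip: mult.assoc)
    qed
    then have "good (insert s A)"
      unfolding good_def using closed step by blast
    then show False using max s by blast
  qed
  with A show ?thesis
    by (auto simp: good_def)
qed

section \<open>Vanishing of the left defect\<close>

text \<open>\<open>left_defect \<eta> g x\<close> is the value at \<open>(1 - \<eta>) x\<close> of the linear extension of \<open>g\<close>.\<close>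

definition left_defect :: "('a::{finite, semigroup_mult} \<Rightarrow> int) \<Rightarrow> ('a \<Rightarrow> int) \<Rightarrow> 'a \<Rightarrow> int" where
  "left_defect \<eta> g x = g x - (\<Sum>v\<in>UNIV. \<eta> v * g (v * x))"

lemma left_defect_mult: "left_defect \<eta> g (y * w) = left_defect \<eta> (\<lambda>u. g (u * w)) y"
  by (simp add: left_defect_def mult.assoc)

lemma left_defect_diff:
  "left_defect \<eta> (\<lambda>u. f u - g u) x = left_defect \<eta> f x - left_defect \<eta> g x"
  by (simp add: left_defect_def algebra_simps sum_subtractf)

context
  fixes \<eta> :: "'a::{finite, semigroup_mult} \<Rightarrow> int"
  assumes right_identity: "\<And>g s. (\<Sum>v\<in>UNIV. \<eta> v * g (s * v)) = g s"
begin

text \<open>This is \<open>e(1 - \<eta>) = 0\<close>, multiplied by \<open>x\<close> on the right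
  and evaluated under \<open>g\<close>.\<close>

lemma left_defect_translate: "left_defect \<eta> (\<lambda>z. g (e * z)) x = 0"
  using right_identity[of "\<lambda>z. g (z * x)" e] by (simp add: left_defect_def mult.assoc)

text \<open>The right identity property gives \<open>\<eta>\<eta> = \<eta>\<close>, so
  \<open>1 - \<eta>\<close> is idempotent.\<close>

lemma left_defect_idem: "left_defect \<eta> (left_defect \<eta> g) = left_defect \<eta> g"
proof
  fix x
  have "(\<Sum>v\<in>UNIV. \<eta> v * (\<Sum>u\<in>UNIV. \<eta> u * g (u * (v * x)))) =
      (\<Sum>v\<in>UNIV. \<Sum>u\<in>UNIV. \<eta> u * (\<eta> v * g (u * v * x)))"
    by (simp add: sum_distrib_left mult.left_commute mult.assoc[symmetric, where 'a='a])
  also have "\<dots> = (\<Sum>u\<in>UNIV. \<eta> u * (\<Sum>v\<in>UNIV. \<eta> v * g (u * v * x)))"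
    by (subst sum.swap) (simp add: sum_distrib_left)
  also have "\<dots> = (\<Sum>u\<in>UNIV. \<eta> u * g (u * x))"
    by (simp add: right_identity[of "\<lambda>z. g (z * x)"])
  finally show "left_defect \<eta> (left_defect \<eta> g) x = left_defect \<eta> g x"
    by (simp add: left_defect_def algebra_simps sum_subtractf)
qed

text \<open>One layer of the filtration of the integral semigroup ring by the ideals spanned by
  \<open>{z. card (c_hom z) < n}\<close>.\<close>

lemma left_defect_layer:
  fixes h :: "'a \<Rightarrow> int"
  assumes R: "R_trivial TYPE('a)" and conn: "connected_semigroup TYPE('a)"
    and fixed: "left_defect \<eta> h = h"
    and low: "\<And>z. card (c_hom z) < n \<Longrightarrow> h z = 0"
    and IH: "\<And>g. (\<And>z. card (c_hom z) \<le> n \<Longrightarrow> g z = 0) \<Longrightarrow> left_defect \<eta> g = (\<lambda>_. 0)"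
    and r: "card (c_hom r) = n"
  shows "h r = 0"
proof -
  define T where "T = {t. c_hom t = c_hom r}"
  \<comment> \<open>\<open>c_hom (u * t)\<close> lies in both \<open>c_hom u\<close> and
    \<open>c_hom t\<close>. Cardinality at least \<open>n\<close> would force equality with both,
    hence \<open>u\<close> in \<open>T\<close>.\<close>
  have fall: "h (u * t) = 0" if "card (c_hom u) \<le> n" "u \<notin> T" "t \<in> T" for u t
  proof (rule low, rule ccontr)
    assume "\<not> card (c_hom (u * t)) < n"
    then have "n \<le> card (c_hom (u * t))" by simp
    moreover have "card (c_hom t) = n"
      using that r by (simp add: T_def)
    ultimately have "c_hom (u * t) = c_hom t" "c_hom (u * t) = c_hom u"
      using that(1) c_hom_mult_subset[OF R, of u t] by (simp_all add: card_seteq)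
    then show False using that by (simp add: T_def)
  qed
  have T_mult: "u * t \<in> T" if "u \<in> T" "t \<in> T" for u t
    using that c_hom_mult_same[OF R, of u t] by (simp add: T_def)
  \<comment> \<open>If \<open>y\<close> fixes \<open>p\<close> and \<open>q\<close>, then \<open>(1 - \<eta>)(p - q) = (1 - \<eta>) ((1 - \<eta>) y) (p - q)\<close>, and modulo
    the span of the smaller layers \<open>(1 - \<eta>) y\<close> is a combination of elements of \<open>T\<close>.\<close>
  have pair: "h p = h q"
    if "p \<in> T" "q \<in> T" "y * p = p" "y * q = q" "\<And>u. u \<in> T \<Longrightarrow> h (u * p) = h (u * q)" for p q y
  proof -
    have "left_defect \<eta> (\<lambda>u. h (u * p) - h (u * q)) = (\<lambda>_. 0)"
    proof (rule IH)
      fix u :: 'a assume "card (c_hom u) \<le> n"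
      then show "h (u * p) - h (u * q) = 0"
        using that fall by (cases "u \<in> T") simp_all
    qed
    then have "left_defect \<eta> h (y * p) = left_defect \<eta> h (y * q)"
      by (simp add: left_defect_mult fun_eq_iff left_defect_diff)
    then show ?thesis
      using that by (simp add: fixed)
  qed
  \<comment> \<open>Induction on the left ideal generated by \<open>w\<close>. An idempotent
    \<open>w\<close> absorbs \<open>s\<close> and \<open>t\<close>. Otherwise a left fixer of
    \<open>w\<close> lets \<open>pair\<close> pass to \<open>u * w\<close>, whose left ideal is
    strictly smaller: recovering \<open>w\<close> from \<open>u * w\<close> would make
    \<open>w\<close> idempotent.\<close>
  have const_left: "h (w * s) = h (w * t)" if "w \<in> T" "s \<in> T" "t \<in> T" for w s t
    using that(1)
  proof (induction "card (insert w (left_ideal w))" arbitrary: w rule: less_induct)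
    case less
    show ?case
    proof (cases "w * w = w")
      case True
      then have "w * s = w" "w * t = w"
        using idem_fixed_iff[OF R True] less.prems that by (auto simp: T_def)
      then show ?thesis by simp
    next
      case False
      obtain y where y: "y * w = w"
        using connected_left_fixed[OF conn] by blast
      show ?thesis
      proof (rule pair[where y = y])
        fix u assume u: "u \<in> T"
        have "insert (u * w) (left_ideal (u * w)) \<subseteq> insert w (left_ideal w)"
          by (auto simp: left_ideal_def simp flip: mult.assoc)
        moreover have "w \<notin> insert (u * w) (left_ideal (u * w))"
        proof
          assume "w \<in> insert (u * w) (left_ideal (u * w))"
          then consider "u * w = w" | v where "w = v * (u * w)"
            by (auto simp: left_ideal_def)
          then show False
          proof cases
            case 1
            then show False
              using idem_if_left_fixed[OF R, of u w] False u less.prems by (simp add: T_def)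
          next
            case 2
            then have "v * u * w = w" by (metis mult.assoc)
            then show False
              using idem_if_left_fixed[OF R, of "v * u" w] False u less.prems
                c_hom_mult_subset(2)[OF R, of v u] by (simp add: T_def)
          qed
        qed
        ultimately have "insert (u * w) (left_ideal (u * w)) \<subset> insert w (left_ideal w)"
          by blast
        then have "card (insert (u * w) (left_ideal (u * w))) < card (insert w (left_ideal w))"
          by (intro psubset_card_mono) simp_all
        then show "h (u * (w * s)) = h (u * (w * t))"
          using less.hyps[of "u * w"] u less.prems T_mult by (simp add: mult.assoc)
      qed (use y less.prems that T_mult in \<open>simp_all flip: mult.assoc\<close>)
    qed
  qed
  \<comment> \<open>The witness of each edge serves as \<open>y\<close> in \<open>pair\<close>,
    whose remaining premise is \<open>const_left\<close>.\<close>
  have const: "h s = h t" if "s \<in> T" "t \<in> T" for s t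
  proof -
    have "equivclp edge s t"
      using that conn by (simp add: connected_semigroup_iff T_def)
    then show ?thesis
    proof (induction rule: equivclp_induct)
      case (step y z)
      have "y \<in> T" "z \<in> T"
        using edge_c_hom[OF step(1)] step(2) that by (auto simp: T_def edge_def)
      then have "h y = h z"
        using step(2) pair const_left by (metis edge_def)
      then show ?case using step by simp
    qed simp
  qed
  define e where "e = omega r"
  have e: "e * e = e" "e \<in> T"
    by (simp_all add: e_def T_def omega_idem c_hom_omega)
  \<comment> \<open>As a function of \<open>u\<close> this depends only on \<open>e * u\<close>, so
    \<open>left_defect_translate\<close> applies. If \<open>e * u\<close> differs from
    \<open>e\<close>, then \<open>u * e\<close> lies in a smaller layer, where \<open>h\<close>
    vanishes.\<close>
  have "h (u * e) = (if e * u = e then h e else 0)" for u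
  proof (cases "e * u = e")
    case True
    then have "e * (u * e) = e"
      using e(1) by (metis mult.assoc)
    then have "c_hom (u * e) = c_hom e"
      using idem_fixed_iff[OF R e(1), of "u * e"] c_hom_mult_subset(2)[OF R, of u e] by simp
    then have "u * e \<in> T"
      using e(2) by (simp add: T_def)
    then have "h (u * e) = h e"
      using const e(2) by blast
    then show ?thesis using True by simp
  next
    case False
    have "\<not> n \<le> card (c_hom (u * e))"
    proof
      assume "n \<le> card (c_hom (u * e))"
      then have "c_hom (u * e) = c_hom e"
        using e r c_hom_mult_subset(2)[OF R, of u e] by (intro card_seteq) (auto simp: T_def)
      then have "e * (u * e) = e"
        using idem_fixed_iff[OF R e(1)] by simp
      then show False
        using False idem_fixed_mult_iff[OF R] by metis
    qed
    then show ?thesis using False low by simp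
  qed
  then have "left_defect \<eta> h (e * e) = 0"
    using left_defect_translate[of "\<lambda>z. if z = e then h e else 0" e e]
    by (simp add: left_defect_mult)
  then have "h e = 0"
    by (simp add: fixed e)
  then show ?thesis
    using const[of r e] e by (simp add: T_def)
qed

text \<open>Descending induction on \<open>n\<close>, starting where \<open>g\<close> must be zero.
  The layer lemma kills \<open>h = left_defect \<eta> g\<close> on layer \<open>n\<close>, so the
  induction hypothesis gives \<open>left_defect \<eta> h = 0\<close>, and the left side is
  \<open>h\<close> again.\<close>

lemma connected_left_defect:
  assumes R: "R_trivial TYPE('a)" and conn: "connected_semigroup TYPE('a)"
    and "\<And>z. card (c_hom z) < n \<Longrightarrow> g z = 0"
  shows "left_defect \<eta> g = (\<lambda>_. 0)"
proof -
  have "left_defect \<eta> g = (\<lambda>_. 0)" if "n \<le> Suc (card (UNIV :: 'a set))"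
    using that assms(3)
  proof (induction arbitrary: g rule: inc_induct)
    case base
    have "g z = 0" for z
      using base card_mono[of "UNIV :: 'a set" "c_hom z"] by (simp add: le_imp_less_Suc)
    then show ?case
      by (simp add: left_defect_def fun_eq_iff)
  next
    case (step n)
    define h where "h = left_defect \<eta> g"
    have fixed: "left_defect \<eta> h = h"
      by (simp add: h_def left_defect_idem)
    have low: "h z = 0" if "card (c_hom z) < n" for z
    proof -
      have "card (c_hom (v * z)) < n" for v
        using card_mono[OF _ c_hom_mult_subset(2)[OF R, of v z]] that by simp
      then show ?thesis
        using that by (simp add: h_def left_defect_def step.prems)
    qed
    have IH: "left_defect \<eta> g = (\<lambda>_. 0)" if "\<And>z. card (c_hom z) \<le> n \<Longrightarrow> g z = 0" for g
      using that by (intro step.IH) simp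
    have "left_defect \<eta> h = (\<lambda>_. 0)"
      using left_defect_layer[OF R conn fixed low IH] low by (intro IH) (metis le_neq_implies_less)
    then show ?case
      using fixed by (simp add: h_def)
  qed
  moreover have ?thesis if "n > card (UNIV :: 'a set)"
  proof -
    have "g z = 0" for z
      using assms(3)[of z] that card_mono[of "UNIV :: 'a set" "c_hom z"] by simp
    then show ?thesis
      by (simp add: left_defect_def fun_eq_iff)
  qed
  ultimately show ?thesis by linarith
qed

end

lemma connected_two_sided_identity:
  assumes R: "R_trivial TYPE('a::{finite, semigroup_mult})" and conn: "connected_semigroup TYPE('a)"
  shows "\<exists>\<eta> :: 'a \<Rightarrow> int. (\<forall>g s. (\<Sum>v\<in>UNIV. \<eta> v * g (s * v)) = g s) \<and>
    (\<forall>g s. (\<Sum>v\<in>UNIV. \<eta> v * g (v * s)) = g s)"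
proof -
  have stab: "\<And>s :: 'a. \<exists>x. s * x = s"
    using conn by (simp add: connected_semigroup_iff)
  obtain \<eta> :: "'a \<Rightarrow> int" where \<eta>: "\<And>g s. (\<Sum>v\<in>UNIV. \<eta> v * g (s * v)) = g s"
    using right_identity_exists[OF R stab] by blast
  moreover have "(\<Sum>v\<in>UNIV. \<eta> v * g (v * s)) = g s" for g s
  proof -
    have "left_defect \<eta> g = (\<lambda>_. 0)"
      \<comment> \<open>At \<open>n = 0\<close> the vanishing condition on \<open>g\<close> is
        empty.\<close>
      using connected_left_defect[OF \<eta> R conn, of 0 g] by simp
    from fun_cong[OF this, of s] show ?thesis
      unfolding left_defect_def by linarith
  qed
  ultimately show ?thesis by blast
qed


section \<open>Change of coefficients\<close>

lemma (in ring) add_pow_int_sum: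
  assumes "finite A"
  shows "[(\<Sum>x\<in>A. \<eta> x :: int)] \<cdot> \<one> = (\<Oplus>x\<in>A. [\<eta> x] \<cdot> \<one>)"
  using assms by (induction A) (simp_all add: add.int_pow_mult add_pow_int_ge Pi_def)

context cring
begin

text \<open>Grouping by the right factor isolates the \<open>u\<close>-coordinate of the product of
  \<open>a\<close> with each basis element \<open>q\<close>.\<close>

lemma conv_regroup_left:
  fixes u :: "'s::{finite, semigroup_mult}"
  assumes a: "a \<in> UNIV \<rightarrow> carrier R" and f: "f \<in> UNIV \<rightarrow> carrier R"
  shows "(\<Oplus>p\<in>{p. fst p * snd p = u}. a (fst p) \<otimes> f (snd p)) =
    (\<Oplus>q\<in>UNIV. (\<Oplus>x\<in>{x. x * q = u}. a x) \<otimes> f q)"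
proof -
  have "{p. fst p * snd p = u} = (\<Union>q\<in>UNIV. (\<lambda>x. (x, q)) ` {x. x * q = u})"
    by (auto simp: image_iff)
  then have "(\<Oplus>p\<in>{p. fst p * snd p = u}. a (fst p) \<otimes> f (snd p)) =
      (\<Oplus>q\<in>UNIV. \<Oplus>p\<in>(\<lambda>x. (x, q)) ` {x. x * q = u}. a (fst p) \<otimes> f (snd p))"
    using a f by (simp only:) (rule add.finprod_UN_disjoint; auto simp: pairwise_def disjnt_def Pi_def)
  also have "\<dots> = (\<Oplus>q\<in>UNIV. \<Oplus>x\<in>{x. x * q = u}. a x \<otimes> f q)"
    using a f by (intro finsum_cong' refl) (auto simp: finsum_reindex inj_on_def Pi_def)
  also have "\<dots> = (\<Oplus>q\<in>UNIV. (\<Oplus>x\<in>{x. x * q = u}. a x) \<otimes> f q)"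
    using a f by (intro finsum_cong' refl) (auto simp: finsum_ldistr Pi_def)
  finally show ?thesis .
qed

lemma conv_regroup_right:
  fixes u :: "'s::{finite, semigroup_mult}"
  assumes a: "a \<in> UNIV \<rightarrow> carrier R" and f: "f \<in> UNIV \<rightarrow> carrier R"
  shows "(\<Oplus>p\<in>{p. fst p * snd p = u}. f (fst p) \<otimes> a (snd p)) =
    (\<Oplus>q\<in>UNIV. f q \<otimes> (\<Oplus>x\<in>{x. q * x = u}. a x))"
proof -
  have "{p. fst p * snd p = u} = (\<Union>q\<in>UNIV. (\<lambda>x. (q, x)) ` {x. q * x = u})"
    by (auto simp: image_iff)
  then have "(\<Oplus>p\<in>{p. fst p * snd p = u}. f (fst p) \<otimes> a (snd p)) =
      (\<Oplus>q\<in>UNIV. \<Oplus>p\<in>(\<lambda>x. (q, x)) ` {x. q * x = u}. f (fst p) \<otimes> a (snd p))"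
    using a f by (simp only:) (rule add.finprod_UN_disjoint; auto simp: pairwise_def disjnt_def Pi_def)
  also have "\<dots> = (\<Oplus>q\<in>UNIV. \<Oplus>x\<in>{x. q * x = u}. f q \<otimes> a x)"
    using a f by (intro finsum_cong' refl) (auto simp: finsum_reindex inj_on_def Pi_def)
  also have "\<dots> = (\<Oplus>q\<in>UNIV. f q \<otimes> (\<Oplus>x\<in>{x. q * x = u}. a x))"
    using a f by (intro finsum_cong' refl) (auto simp: finsum_rdistr Pi_def)
  finally show ?thesis .
qed

lemma finsum_indicator_left:
  assumes "f \<in> (UNIV :: 's::finite set) \<rightarrow> carrier R"
  shows "(\<Oplus>q\<in>UNIV. (if q = u then \<one> else \<zero>) \<otimes> f q) = f u"
proof -
  have "(\<Oplus>q\<in>UNIV. (if q = u then \<one> else \<zero>) \<otimes> f q) = (\<Oplus>q\<in>UNIV. if q = u then f q else \<zero>)"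
    using assms by (intro finsum_cong' refl) (auto simp: Pi_def)
  also have "\<dots> = f u"
    using assms by (intro add.finprod_singleton_swap) auto
  finally show ?thesis .
qed

lemma finsum_indicator_right:
  assumes "f \<in> (UNIV :: 's::finite set) \<rightarrow> carrier R"
  shows "(\<Oplus>q\<in>UNIV. f q \<otimes> (if q = u then \<one> else \<zero>)) = f u"
proof -
  have "(\<Oplus>q\<in>UNIV. f q \<otimes> (if q = u then \<one> else \<zero>)) = (\<Oplus>q\<in>UNIV. if q = u then f q else \<zero>)"
    using assms by (intro finsum_cong' refl) (auto simp: Pi_def)
  also have "\<dots> = f u"
    using assms by (intro add.finprod_singleton_swap) auto
  finally show ?thesis .
qed

lemma unital_of_int_identity:
  fixes \<eta> :: "'s::{finite, semigroup_mult} \<Rightarrow> int"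
  assumes right: "\<And>g s. (\<Sum>v\<in>UNIV. \<eta> v * g (s * v)) = g s"
    and left: "\<And>g s. (\<Sum>v\<in>UNIV. \<eta> v * g (v * s)) = g s"
  shows "unital (semigroup_algebra R TYPE('s))"
proof -
  define a where "a x = [\<eta> x] \<cdot> \<one>" for x
  have a: "a \<in> UNIV \<rightarrow> carrier R"
    by (simp add: a_def)
  have zero_one: "[(if b then 1 else 0 :: int)] \<cdot> \<one> = (if b then \<one> else \<zero>)" for b
    by (simp add: add_pow_int_ge)
  \<comment> \<open>Testing on the indicator of \<open>u\<close> reads off coordinates, which can
    then be mapped from the integers into the coefficient ring.\<close>
  have "(\<Sum>x | x * q = u. \<eta> x) = (if q = u then 1 else 0)" for q u
    using left[of "\<lambda>z. if z = u then 1 else 0" q]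
    by (simp add: if_distrib[of "\<lambda>c. _ * c"] sum.If_cases cong: if_cong)
  then have left': "(\<Oplus>x\<in>{x. x * q = u}. a x) = (if q = u then \<one> else \<zero>)" for q u
    using add_pow_int_sum[of "{x. x * q = u}" \<eta>] zero_one[of "q = u"] by (simp add: a_def)
  have "(\<Sum>x | q * x = u. \<eta> x) = (if q = u then 1 else 0)" for q u
    using right[of "\<lambda>z. if z = u then 1 else 0" q]
    by (simp add: if_distrib[of "\<lambda>c. _ * c"] sum.If_cases cong: if_cong)
  then have right': "(\<Oplus>x\<in>{x. q * x = u}. a x) = (if q = u then \<one> else \<zero>)" for q u
    using add_pow_int_sum[of "{x. q * x = u}" \<eta>] zero_one[of "q = u"] by (simp add: a_def)
  show ?thesis
    unfolding unital_def
  proof (intro bexI[of _ a] ballI conjI)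
    fix f assume "f \<in> carrier (semigroup_algebra R TYPE('s))"
    then have f: "f \<in> UNIV \<rightarrow> carrier R"
      by (simp add: semigroup_algebra_def)
    show "a \<otimes>\<^bsub>semigroup_algebra R TYPE('s)\<^esub> f = f"
      using conv_regroup_left[OF a f] finsum_indicator_left[OF f]
      by (simp add: semigroup_algebra_def left' fun_eq_iff)
    show "f \<otimes>\<^bsub>semigroup_algebra R TYPE('s)\<^esub> a = f"
      using conv_regroup_right[OF a f] finsum_indicator_right[OF f]
      by (simp add: semigroup_algebra_def right' fun_eq_iff)
  qed (use a in \<open>simp add: semigroup_algebra_def\<close>)
qed

lemma connected_imp_unital:
  assumes triv: "R_trivial TYPE('s::{finite, semigroup_mult})"
    and conn: "connected_semigroup TYPE('s)"
  shows "unital (semigroup_algebra R TYPE('s))"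
proof -
  obtain \<eta> :: "'s \<Rightarrow> int" where "\<And>g s. (\<Sum>v\<in>UNIV. \<eta> v * g (s * v)) = g s"
    and "\<And>g s. (\<Sum>v\<in>UNIV. \<eta> v * g (v * s)) = g s"
    using connected_two_sided_identity[OF triv conn] by blast
  then show ?thesis
    by (rule unital_of_int_identity)
qed

section \<open>From an identity to connectedness\<close>

lemma unital_imp_connected:
  assumes triv: "R_trivial TYPE('s::{finite, semigroup_mult})"
    and nontriv: "\<one> \<noteq> \<zero>"
    and unital: "unital (semigroup_algebra R TYPE('s))"
  shows "connected_semigroup TYPE('s)"
proof -
  from unital obtain a :: "'s \<Rightarrow> _" where a: "a \<in> UNIV \<rightarrow> carrier R"
    and id: "\<And>f u. f \<in> UNIV \<rightarrow> carrier R \<Longrightarrow>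
        (\<Oplus>p\<in>{p. fst p * snd p = u}. a (fst p) \<otimes> f (snd p)) = f u"
      "\<And>f u. f \<in> UNIV \<rightarrow> carrier R \<Longrightarrow>
        (\<Oplus>p\<in>{p. fst p * snd p = u}. f (fst p) \<otimes> a (snd p)) = f u"
    by (auto simp: unital_def semigroup_algebra_def fun_eq_iff)
  define d where "d s = (\<lambda>q. if q = s then \<one> else \<zero>)" for s :: 's
  have d: "d s \<in> UNIV \<rightarrow> carrier R" for s
    by (simp add: d_def)
  have left: "(\<Oplus>x\<in>{x. x * s = u}. a x) = d s u" for s u
  proof -
    have "(\<lambda>q. \<Oplus>x\<in>{x. x * q = u}. a x) \<in> UNIV \<rightarrow> carrier R"
      using a by (auto intro!: finsum_closed)
    from finsum_indicator_right[OF this, of s] show ?thesis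
      using conv_regroup_left[OF a d, of s u] id(1)[OF d, of s u] by (simp add: d_def)
  qed
  have right: "(\<Oplus>x\<in>{x. s * x = u}. a x) = d s u" for s u
  proof -
    have "(\<lambda>q. \<Oplus>x\<in>{x. q * x = u}. a x) \<in> UNIV \<rightarrow> carrier R"
      using a by (auto intro!: finsum_closed)
    from finsum_indicator_left[OF this, of s] show ?thesis
      using conv_regroup_right[OF a d, of s u] id(2)[OF d, of s u] by (simp add: d_def)
  qed
  \<comment> \<open>Without such a \<open>y\<close> the sum in \<open>left\<close> would be empty,
    giving \<open>\<zero> = \<one>\<close>.\<close>
  have left_fixed: "\<exists>y. y * s = s" for s :: 's
    using left[of s s] nontriv by (cases "{x. x * s = s} = {}") (auto simp: d_def)
  have right_fixed: "\<exists>y. s * y = s" for s :: 's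
    using right[of s s] nontriv by (cases "{x. s * x = s} = {}") (auto simp: d_def)
  have total: "(\<Oplus>x\<in>{x. x * s \<in> C}. a x) = (if s \<in> C then \<one> else \<zero>)" for s C
  proof -
    have "{x. x * s \<in> C} = (\<Union>u\<in>C. {x. x * s = u})"
      by auto
    then have "(\<Oplus>x\<in>{x. x * s \<in> C}. a x) = (\<Oplus>u\<in>C. \<Oplus>x\<in>{x. x * s = u}. a x)"
      using a by (simp only:) (rule add.finprod_UN_disjoint; auto simp: pairwise_def disjnt_def)
    also have "\<dots> = (\<Oplus>u\<in>C. if s = u then \<one> else \<zero>)"
      by (intro finsum_cong' refl) (auto simp: left d_def)
    also have "\<dots> = (if s \<in> C then \<one> else \<zero>)"
    proof (cases "s \<in> C")
      case True
      then show ?thesis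
        using finsum_singleton[of s C "\<lambda>_. \<one>"] by simp
    next
      case False
      then have "(\<Oplus>u\<in>C. if s = u then \<one> else \<zero>) = (\<Oplus>u\<in>C. \<zero>)"
        by (intro finsum_cong' refl) auto
      then show ?thesis using False by simp
    qed
    finally show ?thesis .
  qed
  have "equivclp edge s t" if c: "c_hom s = c_hom t" for s t :: 's
  proof -
    \<comment> \<open>A left fixer of \<open>x\<close> fixes both products.\<close>
    have "edge (x * s) (x * t)" for x
      using left_fixed[of x] c_hom_mult_cong[OF triv c, of x] unfolding edge_def
      by (metis mult.assoc)
    then have "equivclp edge s (x * s) \<longleftrightarrow> equivclp edge s (x * t)" for x
      by (meson equivclp_sym equivclp_trans r_into_equivclp)
    then have "{x. x * s \<in> Collect (equivclp edge s)} = {x. x * t \<in> Collect (equivclp edge s)}"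
      by simp
    then have "(if equivclp edge s s then \<one> else \<zero>) = (if equivclp edge s t then \<one> else \<zero>)"
      using total[of s "Collect (equivclp edge s)"] total[of t "Collect (equivclp edge s)"] by simp
    then show ?thesis
      using nontriv by (auto split: if_splits)
  qed
  then show ?thesis
    by (simp add: connected_semigroup_iff right_fixed)
qed

end

text \<open>The field with two elements when \<open>z \<noteq> i\<close>: a nonzero coefficient ring
  available on the type \<open>'r\<close>.\<close>

definition two_ring :: "'r \<Rightarrow> 'r \<Rightarrow> 'r ring" where
  "two_ring z i = \<lparr>carrier = {z, i}, monoid.mult = (\<lambda>x y. if x = i \<and> y = i then i else z),
    one = i, zero = z, add = (\<lambda>x y. if x = y then z else i)\<rparr>"

lemma two_ring_cring:
  assumes "z \<noteq> i"
  shows "cring (two_ring z i)"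
proof (rule cringI)
  show "abelian_group (two_ring z i)"
    by (rule abelian_groupI) (use assms in \<open>auto simp: two_ring_def\<close>)
  show "comm_monoid (two_ring z i)"
    by (rule comm_monoidI) (use assms in \<open>auto simp: two_ring_def\<close>)
qed (use assms in \<open>auto simp: two_ring_def\<close>)

theorem theorem3p4:
  assumes "R_trivial TYPE('a::{finite, semigroup_mult})"
    and "infinite (UNIV :: 'r set)"
  shows "(connected_semigroup TYPE('a) \<longleftrightarrow> unital (semigroup_algebra int_ring TYPE('a))) \<and>
         (connected_semigroup TYPE('a) \<longleftrightarrow>
            (\<forall>k :: 'r ring. cring k \<longrightarrow> unital (semigroup_algebra k TYPE('a))))"
proof -
  have int: "cring int_ring"
    by (rule int_is_cring)
  obtain z i :: 'r where "z \<noteq> i"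
    using assms(2) by (metis (full_types) UNIV_I finite.simps finite_subset insertCI subsetI)
  then have two: "cring (two_ring z i)" "\<one>\<^bsub>two_ring z i\<^esub> \<noteq> \<zero>\<^bsub>two_ring z i\<^esub>"
    by (simp_all add: two_ring_cring) (simp add: two_ring_def)
  have "connected_semigroup TYPE('a)" if "unital (semigroup_algebra int_ring TYPE('a))"
    using cring.unital_imp_connected[OF int assms(1) _ that] by simp
  moreover have "connected_semigroup TYPE('a)"
    if "\<forall>k :: 'r ring. cring k \<longrightarrow> unital (semigroup_algebra k TYPE('a))"
    using cring.unital_imp_connected[OF two(1) assms(1) two(2)] that two(1) by blast
  ultimately show ?thesis
    using cring.connected_imp_unital[OF int assms(1)] cring.connected_imp_unital[OF _ assms(1)]
    by blast
qed

end
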